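(* Let $\alpha\in(0,1]$, let $\mathbb{T}$ be a time scale, let $f:\mathbb{R}\to\mathbb{R}$ be continuously differentiable, and let $g:\mathbb{T}\to\mathbb{R}$ be $\alpha$-fractional differentiable (at every $t\in\mathbb{T}^\kappa$ with $t>0$). Then $f\circ g:\mathbb{T}\to\mathbb{R}$ is also $\alpha$-fractional differentiable (at every $t\in\mathbb{T}^\kappa$ with $t>0$), and for all such $t$ $$T_\alpha(f\circ g)(t)=\left[\int_0^1 f'\left(g(t)+h\,\mu(t)\,t^{\alpha-1}\,T_\alpha(g)(t)\right)dh\right]T_\alpha(g)(t).$$
   Context: A time scale $\mathbb{T}$ is a nonempty closed subset of $\mathbb{R}$. The forward jump operator is $\sigma(t)=\inf\{s\in\mathbb{T}:s>t\}$ (with $\sigma(t)=t$ if $t=\max\mathbb{T}$), and the graininess is $\mu(t)=\sigma(t)-t$. $\mathbb{T}^\kappa$ is $\mathbb{T}$ with its maximum removed if that maximum exists and is left-scattered (isolated from the left in $\mathbb{T}$), and $\mathbb{T}^\kappa=\mathbb{T}$ otherwise. $\alpha$-fractional derivative: let $f:\mathbb{T}\to\mathbb{R}$, $t\in\mathbb{T}^\kappa$, $\alpha\in(0,1]$. For $t>0$, $T_\alpha(f)(t)$ is the number (provided it exists) with the property that, given any $\epsilon>0$, there is $\delta>0$ such that $$\left|[f(\sigma(t))-f(s)]\,t^{1-\alpha}-T_\alpha(f)(t)\,[\sigma(t)-s]\right|\le\epsilon\,|\sigma(t)-s|$$ for all $s\in(t-\delta,t+\delta)\cap\mathbb{T}$.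 One says $f$ is $\alpha$-fractional differentiable at $t$ if this number exists. *)

theory Defs
  imports "HOL-Analysis.Analysis"
begin

definition time_scale :: "real set \<Rightarrow> bool" where
  "time_scale T \<longleftrightarrow> T \<noteq> {} \<and> closed T"

definition forward_jump :: "real set \<Rightarrow> real \<Rightarrow> real" where
  "forward_jump T t = (if {s \<in> T. t < s} = {} then t else Inf {s \<in> T. t < s})"

definition graininess :: "real set \<Rightarrow> real \<Rightarrow> real" where
  "graininess T t = forward_jump T t - t"

text \<open>
  Left-scattered is read as isolated from the left. In particular the least element of a
  time scale is left-scattered, so that for a one-point time scale the set
  \<open>kappa_set T\<close> below is empty; at such a point every number would satisfy the defining
  condition of the fractional derivative.
\<close>

definition left_scattered :: "real set \<Rightarrow> real \<Rightarrow> bool" where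
  "left_scattered T t \<longleftrightarrow> (\<exists>e>0. T \<inter> {t - e<..<t} = {})"

definition kappa_set :: "real set \<Rightarrow> real set" where
  "kappa_set T = T - {m \<in> T. (\<forall>s\<in>T. s \<le> m) \<and> left_scattered T m}"

text \<open>
  A function on \<open>T\<close> is given by a total function on the reals; only its values on \<open>T\<close> are used
  (for closed \<open>T\<close> and \<open>t \<in> T\<close> the point \<open>forward_jump T t\<close> lies in \<open>T\<close>).
  The following three notions are meant for \<open>t \<in> kappa_set T\<close> with \<open>0 < t\<close>.
\<close>

definition has_frac_derivative ::
    "real set \<Rightarrow> real \<Rightarrow> (real \<Rightarrow> real) \<Rightarrow> real \<Rightarrow> real \<Rightarrow> bool" where
  "has_frac_derivative T \<alpha> f t D \<longleftrightarrow>
     (\<forall>\<epsilon>>0. \<exists>\<delta>>0. \<forall>s \<in> {t - \<delta><..<t + \<delta>} \<inter> T.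
        \<bar>(f (forward_jump T t) - f s) * t powr (1 - \<alpha>) - D * (forward_jump T t - s)\<bar>
          \<le> \<epsilon> * \<bar>forward_jump T t - s\<bar>)"

definition frac_differentiable ::
    "real set \<Rightarrow> real \<Rightarrow> (real \<Rightarrow> real) \<Rightarrow> real \<Rightarrow> bool" where
  "frac_differentiable T \<alpha> f t \<longleftrightarrow> (\<exists>D. has_frac_derivative T \<alpha> f t D)"

definition frac_deriv :: "real set \<Rightarrow> real \<Rightarrow> (real \<Rightarrow> real) \<Rightarrow> real \<Rightarrow> real" where
  "frac_deriv T \<alpha> f t = (THE D. has_frac_derivative T \<alpha> f t D)"

lemma has_frac_derivative_unique:
  assumes t: "t \<in> kappa_set T"
    and L: "has_frac_derivative T \<alpha> f t L" and M: "has_frac_derivative T \<alpha> f t M"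
  shows "L = M"
proof (rule ccontr)
  assume ne: "L \<noteq> M"
  let ?j = "forward_jump T t"
  define e where "e = \<bar>L - M\<bar> / 4"
  have e: "e > 0" using ne by (simp add: e_def)
  obtain d1 where d1: "d1 > 0" "\<And>s. s \<in> {t - d1<..<t + d1} \<inter> T \<Longrightarrow>
      \<bar>(f ?j - f s) * t powr (1 - \<alpha>) - L * (?j - s)\<bar> \<le> e * \<bar>?j - s\<bar>"
    using L e unfolding has_frac_derivative_def by blast
  obtain d2 where d2: "d2 > 0" "\<And>s. s \<in> {t - d2<..<t + d2} \<inter> T \<Longrightarrow>
      \<bar>(f ?j - f s) * t powr (1 - \<alpha>) - M * (?j - s)\<bar> \<le> e * \<bar>?j - s\<bar>"
    using M e unfolding has_frac_derivative_def by blast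
  define d where "d = min d1 d2"
  have d: "d > 0" using d1 d2 by (simp add: d_def)
  have tT: "t \<in> T" using t by (simp add: kappa_set_def)
  have j: "?j = s" if s: "s \<in> T" "t - d < s" "s < t + d" for s
  proof (rule ccontr)
    assume "?j \<noteq> s"
    then have pos: "\<bar>?j - s\<bar> > 0" by simp
    have sd: "t - d1 < s" "s < t + d1" "t - d2 < s" "s < t + d2"
      using s unfolding d_def by linarith+
    define X where "X = (f ?j - f s) * t powr (1 - \<alpha>)"
    define Y where "Y = ?j - s"
    have "\<bar>X - L * Y\<bar> \<le> e * \<bar>Y\<bar>" "\<bar>X - M * Y\<bar> \<le> e * \<bar>Y\<bar>"
      using d1(2)[of s] d2(2)[of s] sd s(1) unfolding X_def Y_def by simp_all
    then have "\<bar>L * Y - M * Y\<bar> \<le> 2 * (e * \<bar>Y\<bar>)" by linarith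
    then have "\<bar>(L - M) * (?j - s)\<bar> \<le> 2 * e * \<bar>?j - s\<bar>"
      unfolding Y_def[symmetric] by (simp only: left_diff_distrib mult.assoc)
    then have "\<bar>L - M\<bar> * \<bar>?j - s\<bar> \<le> 2 * e * \<bar>?j - s\<bar>" by (simp only: abs_mult)
    with pos have "\<bar>L - M\<bar> \<le> 2 * e" by (simp only: mult_le_cancel_right_pos)
    with e show False by (simp add: e_def)
  qed
  have jt: "?j = t" using j[of t] tT d by simp
  have "left_scattered T t"
    unfolding left_scattered_def using d j jt by (intro exI[of _ d]) force
  then obtain u where u: "u \<in> T" "t < u"
    using t unfolding kappa_set_def by force
  then have "?j = Inf {s \<in> T. t < s}" unfolding forward_jump_def by auto
  moreover have "t + d \<le> Inf {s \<in> T. t < s}"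
    using u j jt d by (intro cInf_greatest) force+
  ultimately show False using jt d by simp
qed

lemma frac_deriv_eqI:
  assumes "t \<in> kappa_set T" and "has_frac_derivative T \<alpha> f t D"
  shows "frac_deriv T \<alpha> f t = D"
  unfolding frac_deriv_def using assms has_frac_derivative_unique by blast

end

theory Submission
  imports Defs
begin

text \<open>
  Write \<open>\<sigma>\<close> for the forward jump of \<open>t\<close>. The integral in the formula is the mean of \<open>f'\<close> over the
  segment from \<open>g t\<close> to \<open>g \<sigma>\<close>: putting \<open>s = t\<close> in the definition of the fractional derivative
  forces \<open>g \<sigma> - g t = \<mu> t\<^sup>\<alpha>\<^sup>-\<^sup>1 D\<close>, where \<open>D\<close> is the derivative of \<open>g\<close> (\<open>frac_derivative_jump\<close>).

  Let \<open>M x\<close> be the mean of \<open>f'\<close> over the segment from \<open>x\<close> to the fixed point \<open>y = g \<sigma>\<close>. By the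
  fundamental theorem of calculus \<open>f y - f x = M x (y - x)\<close>, so \<open>M\<close> is the difference quotient of
  \<open>f\<close> with base point \<open>y\<close>, extended by \<open>f' y\<close> at \<open>y\<close>. By Caratheodory's description of the
  derivative it is therefore continuous (\<open>isCont_mean_deriv\<close>). For \<open>s\<close> in the time scale,
  \[
    (f (g \<sigma>) - f (g s)) c - M (g t) D (\<sigma> - s)
      = M (g s) ((g \<sigma> - g s) c - D (\<sigma> - s)) + (M (g s) - M (g t)) D (\<sigma> - s)
  \]
  where \<open>c = t\<^sup>1\<^sup>-\<^sup>\<alpha>\<close>. As \<open>s\<close> tends to \<open>t\<close>, also \<open>g s\<close> tends to \<open>g t\<close> (\<open>frac_derivative_tendsto\<close>),
  hence \<open>M (g s)\<close> is bounded and \<open>M (g s) - M (g t)\<close> is small, and the right-hand side is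
  \<open>o(\<sigma> - s)\<close>. This treats right-dense and right-scattered points alike.
\<close>

definition mean_deriv :: "(real \<Rightarrow> real) \<Rightarrow> real \<Rightarrow> real \<Rightarrow> real" where
  "mean_deriv f x y = integral {0..1} (\<lambda>h. deriv f (x + h * (y - x)))"

lemma mean_deriv_mult:
  assumes f: "\<And>x. (f has_real_derivative deriv f x) (at x)"
  shows "mean_deriv f x y * (y - x) = f y - f x"
proof -
  have "((\<lambda>h. deriv f (x + h * (y - x)) * (y - x)) has_integral
      f (x + 1 * (y - x)) - f (x + 0 * (y - x))) {0..1}"
  proof (rule fundamental_theorem_of_calculus)
    fix h :: real
    have "((\<lambda>h. f (x + h * (y - x))) has_real_derivative deriv f (x + h * (y - x)) * (y - x))
        (at h within {0..1})"
      by (rule DERIV_chain2[OF f]) (auto intro!: derivative_eq_intros)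
    then show "((\<lambda>h. f (x + h * (y - x))) has_vector_derivative
        deriv f (x + h * (y - x)) * (y - x)) (at h within {0..1})"
      by (simp add: has_real_derivative_iff_has_vector_derivative)
  qed simp
  from integral_unique[OF this] show ?thesis
    by (simp add: mean_deriv_def)
qed

text \<open>
  Caratheodory's theorem at \<open>y\<close> gives a slope function that is continuous at \<open>y\<close>. It agrees with
  the mean everywhere. Away from \<open>y\<close> the mean is an ordinary quotient of continuous functions.
\<close>

lemma isCont_mean_deriv:
  assumes f: "\<And>x. (f has_real_derivative deriv f x) (at x)"
  shows "isCont (\<lambda>x. mean_deriv f x y) a"
proof -
  have quot: "mean_deriv f x y = (f y - f x) / (y - x)" if "x \<noteq> y" for x
    using that mean_deriv_mult[OF f, of x y] by (simp add: field_simps)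
  show ?thesis
  proof (cases "a = y")
    case True
    obtain q where q: "\<And>z. f z - f y = q z * (z - y)" "isCont q y" "q y = deriv f y"
      using f[of y] unfolding CARAT_DERIV by blast
    have "mean_deriv f x y = q x" for x
    proof (cases "x = y")
      case False
      have "f y - f x = q x * (y - x)"
        using q(1)[of x] by (simp add: algebra_simps)
      with False show ?thesis by (simp add: quot)
    qed (simp add: mean_deriv_def q(3))
    then show ?thesis using q(2) True by simp
  next
    case False
    have "isCont (\<lambda>x. (f y - f x) / (y - x)) a"
      using False by (intro continuous_intros DERIV_isCont[OF f]) auto
    moreover have "\<forall>\<^sub>F x in nhds a. mean_deriv f x y = (f y - f x) / (y - x)"
      using t1_space_nhds[OF False] by eventually_elim (rule quot)
    ultimately show ?thesis
      by (simp add: isCont_cong)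
  qed
qed

text \<open>
  The point \<open>s = t\<close> is included in the definition, hence the filter is not the punctured
  \<open>at t within T\<close>.
\<close>

lemma has_frac_derivative_eventually:
  "has_frac_derivative T \<alpha> f t D \<longleftrightarrow>
     (\<forall>\<epsilon>>0. \<forall>\<^sub>F s in inf (nhds t) (principal T).
        \<bar>(f (forward_jump T t) - f s) * t powr (1 - \<alpha>) - D * (forward_jump T t - s)\<bar>
          \<le> \<epsilon> * \<bar>forward_jump T t - s\<bar>)"
proof -
  have ball: "s \<in> {t - d<..<t + d} \<longleftrightarrow> dist s t < d" for s d
    by (auto simp: dist_real_def)
  show ?thesis
    unfolding has_frac_derivative_def eventually_inf_principal eventually_nhds_metric
    by (simp only: Ball_def Int_iff ball) blast
qed

text \<open>At \<open>s = t\<close> the error is at most \<open>\<epsilon> \<bar>\<mu>\<bar>\<close> for every \<open>\<epsilon> > 0\<close>, so it vanishes.\<close>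

lemma frac_derivative_jump:
  assumes "t \<in> T" and D: "has_frac_derivative T \<alpha> g t D"
  shows "(g (forward_jump T t) - g t) * t powr (1 - \<alpha>) = D * graininess T t"
proof -
  let ?E = "\<bar>(g (forward_jump T t) - g t) * t powr (1 - \<alpha>) - D * graininess T t\<bar>"
  have bound: "?E \<le> \<epsilon> * \<bar>graininess T t\<bar>" if \<epsilon>: "0 < \<epsilon>" for \<epsilon>
  proof -
    obtain \<delta> where "\<delta> > 0" and "\<forall>s \<in> {t - \<delta><..<t + \<delta>} \<inter> T.
        \<bar>(g (forward_jump T t) - g s) * t powr (1 - \<alpha>) - D * (forward_jump T t - s)\<bar>
          \<le> \<epsilon> * \<bar>forward_jump T t - s\<bar>"
      using D[unfolded has_frac_derivative_def, rule_format, OF \<epsilon>] by blast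
    then show ?thesis using \<open>t \<in> T\<close> by (simp add: graininess_def)
  qed
  have "?E \<le> 0"
  proof (rule field_le_epsilon)
    fix e :: real assume e: "0 < e"
    have "?E \<le> e / (\<bar>graininess T t\<bar> + 1) * \<bar>graininess T t\<bar>"
      using e by (intro bound) simp
    also have "\<dots> \<le> e"
      using e by (simp add: field_simps)
    finally show "?E \<le> 0 + e" by simp
  qed
  then show ?thesis by simp
qed

text \<open>
  Differentiability implies continuity along \<open>T\<close>: with \<open>\<sigma>\<close> the forward jump of \<open>t\<close>, subtracting
  the exact identity at \<open>s = t\<close> from the estimate at \<open>s\<close> leaves
  \<open>\<bar>(g t - g s) t\<^sup>1\<^sup>-\<^sup>\<alpha> - D (t - s)\<bar> \<le> \<epsilon> \<bar>\<sigma> - s\<bar>\<close>. At a right-scattered point the factor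
  \<open>\<bar>\<sigma> - s\<bar>\<close> does not tend to zero, but it stays bounded.
\<close>

lemma frac_derivative_tendsto:
  assumes "t \<in> T" "0 < t" and D: "has_frac_derivative T \<alpha> g t D"
  shows "(g \<longlongrightarrow> g t) (inf (nhds t) (principal T))"
proof -
  define F where "F = inf (nhds t) (principal T)"
  define j where "j = forward_jump T t"
  define c where "c = t powr (1 - \<alpha>)"
  have c: "c > 0" using \<open>0 < t\<close> by (simp add: c_def)
  have ident: "((\<lambda>s. s) \<longlongrightarrow> t) F"
    unfolding F_def by (rule tendsto_mono[OF inf_le1]) (rule filterlim_ident)
  have jump: "(g j - g t) * c = D * (j - t)"
    using frac_derivative_jump[OF \<open>t \<in> T\<close> D] by (simp add: j_def c_def graininess_def)
  have "((\<lambda>s. (g t - g s) * c - D * (t - s)) \<longlongrightarrow> 0) F"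
  proof (rule tendstoI)
    fix e :: real assume e: "0 < e"
    define \<epsilon> where "\<epsilon> = e / (\<bar>j - t\<bar> + 2)"
    have \<epsilon>: "\<epsilon> > 0" using e by (simp add: \<epsilon>_def)
    have "\<forall>\<^sub>F s in F. \<bar>(g j - g s) * c - D * (j - s)\<bar> \<le> \<epsilon> * \<bar>j - s\<bar>"
      using D \<epsilon> unfolding has_frac_derivative_eventually F_def j_def c_def by blast
    moreover have "\<forall>\<^sub>F s in F. dist s t < 1"
      using tendstoD[OF ident, of 1] by simp
    ultimately show "\<forall>\<^sub>F s in F. dist ((g t - g s) * c - D * (t - s)) 0 < e"
    proof eventually_elim
      case (elim s)
      have "(g t - g s) * c - D * (t - s) = (g j - g s) * c - D * (j - s)"
        using jump by (simp add: algebra_simps)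
      then have "\<bar>(g t - g s) * c - D * (t - s)\<bar> \<le> \<epsilon> * \<bar>j - s\<bar>"
        using elim(1) by simp
      also have "\<dots> < \<epsilon> * (\<bar>j - t\<bar> + 2)"
        using elim(2) \<epsilon> by (intro mult_strict_left_mono) (auto simp: dist_real_def)
      also have "\<dots> = e" by (simp add: \<epsilon>_def)
      finally show ?case by (simp add: dist_real_def)
    qed
  qed
  then have "((\<lambda>s. g t - (((g t - g s) * c - D * (t - s)) + D * (t - s)) / c)
      \<longlongrightarrow> g t - (0 + D * (t - t)) / c) F"
    using c by (intro tendsto_intros ident) auto
  then show ?thesis using c by (simp add: F_def)
qed

lemma has_frac_derivative_compose:
  assumes f: "\<And>x. (f has_real_derivative deriv f x) (at x)"
    and "t \<in> T" "0 < t" and D: "has_frac_derivative T \<alpha> g t D"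
  shows "has_frac_derivative T \<alpha> (f \<circ> g) t (mean_deriv f (g t) (g (forward_jump T t)) * D)"
  unfolding has_frac_derivative_eventually
proof (intro allI impI)
  fix \<epsilon> :: real assume \<epsilon>: "0 < \<epsilon>"
  define F where "F = inf (nhds t) (principal T)"
  define j where "j = forward_jump T t"
  define c where "c = t powr (1 - \<alpha>)"
  define M where "M x = mean_deriv f x (g j)" for x
  define K where "K = \<bar>M (g t)\<bar> + 1"
  have K: "K > 0" by (simp add: K_def add_nonneg_pos)
  have M: "f (g j) - f x = M x * (g j - x)" for x
    by (simp add: M_def mean_deriv_mult[OF f])
  have lim: "((\<lambda>s. M (g s)) \<longlongrightarrow> M (g t)) F"
    unfolding F_def M_def
    by (rule isCont_tendsto_compose[OF isCont_mean_deriv[OF f]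
          frac_derivative_tendsto[OF \<open>t \<in> T\<close> \<open>0 < t\<close> D]])
  have "0 < \<epsilon> / (2 * K)" using \<epsilon> K by simp
  then have "\<forall>\<^sub>F s in F. \<bar>(g j - g s) * c - D * (j - s)\<bar> \<le> \<epsilon> / (2 * K) * \<bar>j - s\<bar>"
    using D unfolding has_frac_derivative_eventually F_def j_def c_def by blast
  moreover have "\<forall>\<^sub>F s in F. dist (M (g s)) (M (g t)) < 1"
    using tendstoD[OF lim, of 1] by simp
  moreover have "\<forall>\<^sub>F s in F. dist (M (g s)) (M (g t)) < \<epsilon> / (2 * (\<bar>D\<bar> + 1))"
    using \<epsilon> by (intro tendstoD[OF lim]) simp
  ultimately have
    "\<forall>\<^sub>F s in F. \<bar>(f (g j) - f (g s)) * c - M (g t) * D * (j - s)\<bar> \<le> \<epsilon> * \<bar>j - s\<bar>"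
  proof eventually_elim
    case (elim s)
    define R where "R = (g j - g s) * c - D * (j - s)"
    have "\<bar>M (g s)\<bar> \<le> K"
      using elim(2) unfolding K_def dist_real_def by linarith
    then have "\<bar>M (g s) * R\<bar> \<le> K * (\<epsilon> / (2 * K) * \<bar>j - s\<bar>)"
      using elim(1) K unfolding abs_mult R_def by (intro mult_mono) auto
    also have "\<dots> = \<epsilon> / 2 * \<bar>j - s\<bar>" using K by simp
    finally have 1: "\<bar>M (g s) * R\<bar> \<le> \<epsilon> / 2 * \<bar>j - s\<bar>" .
    have "\<bar>M (g s) - M (g t)\<bar> * \<bar>D\<bar> \<le> \<epsilon> / (2 * (\<bar>D\<bar> + 1)) * (\<bar>D\<bar> + 1)"
      using elim(3) \<epsilon> by (intro mult_mono) (auto simp: dist_real_def)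
    also have "\<dots> = \<epsilon> / 2"
    proof -
      have "\<bar>D\<bar> + 1 \<noteq> 0" by linarith
      then show ?thesis by (simp add: field_simps)
    qed
    finally have 2: "\<bar>(M (g s) - M (g t)) * D * (j - s)\<bar> \<le> \<epsilon> / 2 * \<bar>j - s\<bar>"
      unfolding abs_mult by (rule mult_right_mono) simp
    have "(f (g j) - f (g s)) * c - M (g t) * D * (j - s)
        = M (g s) * R + (M (g s) - M (g t)) * D * (j - s)"
      unfolding M R_def by (simp add: algebra_simps)
    then have "\<bar>(f (g j) - f (g s)) * c - M (g t) * D * (j - s)\<bar>
        \<le> \<bar>M (g s) * R\<bar> + \<bar>(M (g s) - M (g t)) * D * (j - s)\<bar>"
      using abs_triangle_ineq by metis
    also have "\<dots> \<le> \<epsilon> / 2 * \<bar>j - s\<bar> + \<epsilon> / 2 * \<bar>j - s\<bar>"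
      using 1 2 by (rule add_mono)
    finally show ?case by simp
  qed
  then show "\<forall>\<^sub>F s in inf (nhds t) (principal T).
      \<bar>((f \<circ> g) (forward_jump T t) - (f \<circ> g) s) * t powr (1 - \<alpha>)
        - mean_deriv f (g t) (g (forward_jump T t)) * D * (forward_jump T t - s)\<bar>
      \<le> \<epsilon> * \<bar>forward_jump T t - s\<bar>"
    by (simp add: F_def j_def c_def M_def)
qed

theorem theorem4:
  fixes \<alpha> :: real and T :: "real set" and f g :: "real \<Rightarrow> real"
  assumes "0 < \<alpha>" and "\<alpha> \<le> 1"
    and "time_scale T"
    and "f C1_differentiable_on UNIV"
    and "\<forall>t\<in>kappa_set T. 0 < t \<longrightarrow> frac_differentiable T \<alpha> g t"
  shows "\<forall>t\<in>kappa_set T. 0 < t \<longrightarrow>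
    frac_differentiable T \<alpha> (f \<circ> g) t \<and>
    frac_deriv T \<alpha> (f \<circ> g) t =
      integral {0..1}
        (\<lambda>h. deriv f (g t + h * graininess T t * t powr (\<alpha> - 1) * frac_deriv T \<alpha> g t))
      * frac_deriv T \<alpha> g t"
proof (intro ballI impI)
  fix t assume t: "t \<in> kappa_set T" "0 < t"
  have f: "(f has_real_derivative deriv f x) (at x)" for x
    using \<open>f C1_differentiable_on UNIV\<close> DERIV_deriv_iff_real_differentiable
    by (auto simp: C1_differentiable_on_eq)
  have tT: "t \<in> T" using t(1) by (simp add: kappa_set_def)
  obtain D where D: "has_frac_derivative T \<alpha> g t D"
    using assms(5) t unfolding frac_differentiable_def by blast
  have g': "frac_deriv T \<alpha> g t = D"
    by (rule frac_deriv_eqI[OF t(1) D])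
  have jump: "g (forward_jump T t) - g t = graininess T t * t powr (\<alpha> - 1) * D"
  proof -
    have "t powr (1 - \<alpha>) * t powr (\<alpha> - 1) = 1"
      using t(2) by (simp flip: powr_add)
    then have "g (forward_jump T t) - g t
        = (g (forward_jump T t) - g t) * t powr (1 - \<alpha>) * t powr (\<alpha> - 1)"
      by (simp add: mult.assoc)
    then show ?thesis
      unfolding frac_derivative_jump[OF tT D] by (simp add: mult_ac)
  qed
  have mean: "mean_deriv f (g t) (g (forward_jump T t)) =
      integral {0..1} (\<lambda>h. deriv f (g t + h * graininess T t * t powr (\<alpha> - 1) * D))"
    unfolding mean_deriv_def jump by (simp add: mult.assoc)
  note fg = has_frac_derivative_compose[OF f tT t(2) D]
  show "frac_differentiable T \<alpha> (f \<circ> g) t \<and>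
    frac_deriv T \<alpha> (f \<circ> g) t =
      integral {0..1}
        (\<lambda>h. deriv f (g t + h * graininess T t * t powr (\<alpha> - 1) * frac_deriv T \<alpha> g t))
      * frac_deriv T \<alpha> g t"
    using fg frac_deriv_eqI[OF t(1) fg] unfolding g' mean frac_differentiable_def by blast
qed

end
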